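(* (No rank assumption is made on $C_1,C_2$ in either part.) (a) Let $G_1,G_2$ be linear time-invariant systems $$G_i:\quad \dot x_i=A_ix_i+B_iv_i+E_id_i,\quad w_i=C_ix_i,\quad z_i=F_ix_i,\qquad i=1,2,$$ with the dimension of $v_1$ equal to that of $w_2$ and the dimension of $v_2$ equal to that of $w_1$, and let $G$ be the system with input $(d_1,d_2)$ and output $(z_1,z_2)$ obtained by imposing $v_1=w_2$, $v_2=w_1$. Suppose that $G$ is strictly dissipative with respect to a quadratic supply function $s_{ext}(d_1,d_2,z_1,z_2)=s_{1,ext}(d_1,z_1)+s_{2,ext}(d_2,z_2)$ with a storage function $V(x_1,x_2)=V_1(x_1)+V_2(x_2)$, where $V_1,V_2$ are quadratic. Then there exist quadratic functions $s_{1,int}(v_1,w_1)$, $s_{2,int}(v_2,w_2)$ such that $s_{1,int}(v_1,w_1)+s_{2,int}(v_2,w_2)=0$ whenever $v_1=w_2$, $v_2=w_1$; for $i=1,2$ the system $G_i$ (with input $(v_i,d_i)$ and output $(w_i,z_i)$) is strictly dissipative with respect to $s_{i,ext}(d_i,z_i)+s_{i,int}(v_i,w_i)$ with the storage function $V_i(x_i)$; and $$s_{1,int}(0,w_1)\le0,\quad s_{2,int}(0,w_2)\le0\quad\text{for all } w_1\neq0,\ w_2\neq0.$$ (b) Let $\tilde G_i:\ \dot x_i=A_ix_i+B_iv_i,\ w_i=C_ix_i$, $i=1,2$, with the dimension of $v_1$ equal to that of $w_2$ and the dimension of $v_2$ equal to that of $w_1$, and let $\tilde G$ be the autonomous system obtained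 by imposing $v_1=w_2$, $v_2=w_1$. Suppose $\tilde G$ is stable and admits an additive quadratic Lyapunov function $V(x_1,x_2)=V_1(x_1)+V_2(x_2)$. Then there exist quadratic functions $s_{1,int}(v_1,w_1)$, $s_{2,int}(v_2,w_2)$ such that $s_{1,int}(v_1,w_1)+s_{2,int}(v_2,w_2)=0$ whenever $v_1=w_2$, $v_2=w_1$; for $i=1,2$ the system $\tilde G_i$ is strictly dissipative with respect to $s_{i,int}(v_i,w_i)$ with the storage function $V_i(x_i)$; and $$s_{1,int}(0,w_1)\le0,\quad s_{2,int}(0,w_2)\le0\quad\text{for all } w_1\neq0,\ w_2\neq0.$$
   Context: All matrices are real and of compatible sizes. "Quadratic function" means a quadratic form: a quadratic supply function of input $d$ and output $z$ is $s(d,z)=\begin{pmatrix} d \\ z \end{pmatrix}^\top\begin{pmatrix} Q & S \\ S^\top & R \end{pmatrix}\begin{pmatrix} d \\ z \end{pmatrix}$ with $Q,R$ symmetric, and a quadratic storage function is $V(x)=x^\top Px$ with $P$ symmetric (not required to be positive definite or semidefinite). "Stable" means asymptotically stable. A linear system $\dot x=Ax+Bd$, $z=Cx+Dd$ is strictly dissipative with respect to a quadratic supply function $s(d,z)$ with storage function $V(x)=x^\top Px$ if $2x^\top P(Ax+Bd)<s(d,\,Cx+Dd)$ for all $(x,d)\neq 0$. An additive quadratic Lyapunov function for the autonomous system $\tilde G$, written $\dot x=\mathcal{A}x$ with $x=\mathrm{col}(x_1,x_2)$, $\mathcal{A}=\begin{pmatrix} A_1 & B_1C_2 \\ B_2C_1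 & A_2 \end{pmatrix}$, is $V=V_1+V_2$ with $V_i(x_i)=x_i^\top P_ix_i$, $P_i$ symmetric positive definite, such that $\mathcal{A}^\top P+P\mathcal{A}\prec0$ for $P=\mathrm{diag}(P_1,P_2)$. *)

theory Defs
  imports "HOL-Analysis.Analysis"
begin

text \<open>
  Vectors in \<open>R^n\<close> are of type \<^typ>\<open>real ^ 'n\<close>. Stacked vectors and block matrices are
  indexed by the sum of the index types of their blocks.
\<close>

definition col :: "real ^ 'a \<Rightarrow> real ^ 'b \<Rightarrow> real ^ ('a + 'b)" where
  "col x y = (\<chi> i. case i of Inl a \<Rightarrow> x $ a | Inr b \<Rightarrow> y $ b)"

definition upper :: "real ^ ('a::finite + 'b::finite) \<Rightarrow> real ^ 'a" where
  "upper u = (\<chi> a. u $ Inl a)"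

definition lower :: "real ^ ('a::finite + 'b::finite) \<Rightarrow> real ^ 'b" where
  "lower u = (\<chi> b. u $ Inr b)"

definition vstack :: "real ^ 'n ^ 'a \<Rightarrow> real ^ 'n ^ 'b \<Rightarrow> real ^ 'n ^ ('a + 'b)" where
  "vstack M N = (\<chi> i. case i of Inl a \<Rightarrow> M $ a | Inr b \<Rightarrow> N $ b)"

definition hstack :: "real ^ 'a ^ 'n \<Rightarrow> real ^ 'b ^ 'n \<Rightarrow> real ^ ('a + 'b) ^ 'n" where
  "hstack M N = (\<chi> i. col (M $ i) (N $ i))"

definition block_matrix ::
  "real ^ 'c ^ 'a \<Rightarrow> real ^ 'd ^ 'a \<Rightarrow> real ^ 'c ^ 'b \<Rightarrow> real ^ 'd ^ 'b
    \<Rightarrow> real ^ ('c + 'd) ^ ('a + 'b)" where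
  "block_matrix M11 M12 M21 M22 = vstack (hstack M11 M12) (hstack M21 M22)"

lemma upper_col [simp]: "upper (col x y) = x"
  by (simp add: upper_def col_def)

lemma lower_col [simp]: "lower (col x y) = y"
  by (simp add: lower_def col_def)

lemma col_upper_lower [simp]: "col (upper u) (lower u) = u"
  by (simp add: vec_eq_iff upper_def lower_def col_def split: sum.split)

lemma vstack_mult: "vstack M N *v x = col (M *v x) (N *v x)"
  by (auto simp: vec_eq_iff vstack_def col_def matrix_vector_mult_def split: sum.split)

lemma hstack_mult: "hstack M N *v col x y = M *v x + N *v y"
  by (simp add: vec_eq_iff hstack_def col_def matrix_vector_mult_def
      sum.Plus flip: UNIV_Plus_UNIV)

lemma block_matrix_mult:
  "block_matrix M11 M12 M21 M22 *v col x y = col (M11 *v x + M12 *v y) (M21 *v x + M22 *v y)"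
  by (simp add: block_matrix_def vstack_mult hstack_mult)

definition symmetric_matrix :: "real ^ 'n ^ 'n \<Rightarrow> bool" where
  "symmetric_matrix M \<longleftrightarrow> transpose M = M"

definition pos_def_matrix :: "real ^ 'n ^ 'n \<Rightarrow> bool" where
  "pos_def_matrix M \<longleftrightarrow> symmetric_matrix M \<and> (\<forall>x. x \<noteq> 0 \<longrightarrow> x \<bullet> (M *v x) > 0)"

definition neg_def_matrix :: "real ^ 'n ^ 'n \<Rightarrow> bool" where
  "neg_def_matrix M \<longleftrightarrow> symmetric_matrix M \<and> (\<forall>x. x \<noteq> 0 \<longrightarrow> x \<bullet> (M *v x) < 0)"

definition quadratic_storage :: "(real ^ 'n \<Rightarrow> real) \<Rightarrow> bool" where
  "quadratic_storage V \<longleftrightarrow> (\<exists>P. symmetric_matrix P \<and> (\<forall>x. V x = x \<bullet> (P *v x)))"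

definition quadratic_supply :: "(real ^ 'd \<Rightarrow> real ^ 'z \<Rightarrow> real) \<Rightarrow> bool" where
  "quadratic_supply s \<longleftrightarrow>
    (\<exists>Q S R. symmetric_matrix Q \<and> symmetric_matrix R \<and>
      (\<forall>d z. s d z = col d z \<bullet> (block_matrix Q S (transpose S) R *v col d z)))"

text \<open>
  The system \<open>x' = A x + B d\<close>, \<open>z = C x + D d\<close>. The symmetric matrix \<open>P\<close> is determined by the
  storage function \<open>V\<close>.
\<close>

definition strictly_dissipative ::
  "real ^ 'n ^ 'n \<Rightarrow> real ^ 'd ^ 'n \<Rightarrow> real ^ 'n ^ 'z \<Rightarrow> real ^ 'd ^ 'z
    \<Rightarrow> (real ^ 'd \<Rightarrow> real ^ 'z \<Rightarrow> real) \<Rightarrow> (real ^ 'n \<Rightarrow> real) \<Rightarrow> bool" where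
  "strictly_dissipative A B C D s V \<longleftrightarrow>
    (\<exists>P. symmetric_matrix P \<and> (\<forall>x. V x = x \<bullet> (P *v x)) \<and>
      (\<forall>x d. (x, d) \<noteq> (0, 0) \<longrightarrow>
        2 * (x \<bullet> (P *v (A *v x + B *v d))) < s d (C *v x + D *v d)))"

definition linear_solution :: "real ^ 'n ^ 'n \<Rightarrow> (real \<Rightarrow> real ^ 'n) \<Rightarrow> bool" where
  "linear_solution A x \<longleftrightarrow>
    (\<forall>t\<ge>0. (x has_vector_derivative A *v x t) (at t within {0..}))"

definition asymptotically_stable :: "real ^ 'n ^ 'n \<Rightarrow> bool" where
  "asymptotically_stable A \<longleftrightarrow>
    (\<forall>\<epsilon>>0. \<exists>\<delta>>0. \<forall>x. linear_solution A x \<and> norm (x 0) < \<delta> \<longrightarrow> (\<forall>t\<ge>0. norm (x t) < \<epsilon>)) \<and>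
    (\<exists>\<delta>>0. \<forall>x. linear_solution A x \<and> norm (x 0) < \<delta> \<longrightarrow> (x \<longlongrightarrow> 0) at_top)"

text \<open>
  Imposing \<open>v1 = w2 = C2 x2\<close> and \<open>v2 = w1 = C1 x1\<close> gives the following state matrix for
  \<open>col x1 x2\<close>.
\<close>

definition coupled_matrix ::
  "real ^ 'n1 ^ 'n1 \<Rightarrow> real ^ 'p2 ^ 'n1 \<Rightarrow> real ^ 'n1 ^ 'p1 \<Rightarrow>
   real ^ 'n2 ^ 'n2 \<Rightarrow> real ^ 'p1 ^ 'n2 \<Rightarrow> real ^ 'n2 ^ 'p2 \<Rightarrow>
   real ^ ('n1 + 'n2) ^ ('n1 + 'n2)" where
  "coupled_matrix A1 B1 C1 A2 B2 C2 = block_matrix A1 (B1 ** C2) (B2 ** C1) A2"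

lemma coupled_matrix_mult:
  "coupled_matrix A1 B1 C1 A2 B2 C2 *v col x1 x2 =
    col (A1 *v x1 + B1 *v (C2 *v x2)) (A2 *v x2 + B2 *v (C1 *v x1))"
  by (simp add: coupled_matrix_def block_matrix_mult matrix_vector_mul_assoc add.commute)

definition additive_quadratic_lyapunov ::
  "real ^ ('n1 + 'n2) ^ ('n1 + 'n2) \<Rightarrow> (real ^ 'n1 \<Rightarrow> real) \<Rightarrow> (real ^ 'n2 \<Rightarrow> real) \<Rightarrow> bool" where
  "additive_quadratic_lyapunov A V1 V2 \<longleftrightarrow>
    (\<exists>P1 P2. pos_def_matrix P1 \<and> pos_def_matrix P2 \<and>
      (\<forall>x1. V1 x1 = x1 \<bullet> (P1 *v x1)) \<and> (\<forall>x2. V2 x2 = x2 \<bullet> (P2 *v x2)) \<and>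
      (let P = block_matrix P1 0 0 P2 in neg_def_matrix (transpose A ** P + P ** A)))"

end

theory Submission
  imports Defs
begin

text \<open>
  Write \<open>g\<^sub>i\<close> for the derivative of \<open>V\<^sub>i\<close> along \<open>G\<^sub>i\<close> minus the external supply, a quadratic form in
  \<open>y\<^sub>i = (x\<^sub>i, d\<^sub>i)\<close> and \<open>v\<^sub>i\<close>. The assumption is that \<open>g\<^sub>1 + g\<^sub>2\<close> is negative on the subspace
  \<open>v\<^sub>1 = C\<^sub>2 x\<^sub>2\<close>, \<open>v\<^sub>2 = C\<^sub>1 x\<^sub>1\<close>. By Finsler's lemma the constraints can be traded for penalties: with \<open>v\<close>
  and \<open>w\<close> now independent of \<open>y\<^sub>1\<close> and \<open>y\<^sub>2\<close>, the sum of
  \<open>h\<^sub>1(y\<^sub>1, v, w) = g\<^sub>1(y\<^sub>1, v) - M \<bar>w - C\<^sub>1 x\<^sub>1\<bar>\<^sup>2\<close> and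
  \<open>h\<^sub>2(y\<^sub>2, v, w) = g\<^sub>2(y\<^sub>2, w) - M \<bar>v - C\<^sub>2 x\<^sub>2\<bar>\<^sup>2\<close> is negative definite for large \<open>M\<close>. This is what
  makes rank assumptions on \<open>C\<^sub>1, C\<^sub>2\<close> unnecessary. Each \<open>h\<^sub>i\<close> is negative definite in \<open>y\<^sub>i\<close>, so its maximum
  over \<open>y\<^sub>i\<close> is a quadratic form \<open>H\<^sub>i(v, w)\<close> (a Schur complement), and \<open>H\<^sub>1 + H\<^sub>2\<close> is negative definite.
  Then \<open>s\<^sub>1(v, w) = (H\<^sub>1(v, w) - H\<^sub>2(v, w)) / 2\<close> and \<open>s\<^sub>2(w, v) = - s\<^sub>1(v, w)\<close> are internal supply functions.
  The sign conditions are the two dissipation inequalities at \<open>x\<^sub>i = 0\<close>, \<open>d\<^sub>i = 0\<close>.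
\<close>

subsection \<open>Quadratic forms on Euclidean spaces\<close>

text \<open>Working over arbitrary Euclidean spaces lets product types stand for stacked vectors. A
  symmetric bilinear witness makes it possible to expand \<open>f\<close> without coordinates;
  matrices reappear only in \<open>quadratic_form_imp_quadratic_supply\<close>.\<close>

definition quadratic_form :: "('a::euclidean_space \<Rightarrow> real) \<Rightarrow> bool" where
  "quadratic_form f \<longleftrightarrow>
    (\<exists>b. bilinear b \<and> (\<forall>x y. b x y = b y x) \<and> (\<forall>x. f x = b x x))"

lemma quadratic_form_inner:
  fixes f g :: "'a::euclidean_space \<Rightarrow> 'b::euclidean_space"
  assumes "bounded_linear f" "bounded_linear g"
  shows "quadratic_form (\<lambda>x. f x \<bullet> g x)"
proof -
  interpret f: bounded_linear f by fact
  interpret g: bounded_linear g by fact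
  \<comment> \<open>The map \<open>f x \<bullet> g y\<close> alone may fail to be symmetric, so it
    is averaged with its transpose.\<close>
  have "bilinear (\<lambda>x y. (f x \<bullet> g y + f y \<bullet> g x) / 2)"
    unfolding bilinear_def
    by (auto intro!: linearI simp: f.add g.add f.scaleR g.scaleR algebra_simps add_divide_distrib)
  then show ?thesis
    unfolding quadratic_form_def
    by (intro exI[of _ "\<lambda>x y. (f x \<bullet> g y + f y \<bullet> g x) / 2"]) auto
qed

lemma bilinear_compose:
  assumes "bilinear b" "linear l" "linear m"
  shows "bilinear (\<lambda>x y. b (l x) (m y))"
  using assms linear_compose[of l "\<lambda>x. b x (m _)"] linear_compose[of m "b (l _)"]
  unfolding bilinear_def comp_def by blast

lemma quadratic_form_add:
  assumes "quadratic_form f" "quadratic_form g"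
  shows "quadratic_form (\<lambda>x. f x + g x)"
proof -
  obtain b c where b: "bilinear b" "\<And>x y. b x y = b y x" "\<And>x. f x = b x x"
    and c: "bilinear c" "\<And>x y. c x y = c y x" "\<And>x. g x = c x x"
    using assms unfolding quadratic_form_def by metis
  have "bilinear (\<lambda>x y. b x y + c x y)"
    using b(1) c(1) unfolding bilinear_def by (auto intro: linear_compose_add)
  then show ?thesis
    unfolding quadratic_form_def using b(2,3) c(2,3)
    by (intro exI[of _ "\<lambda>x y. b x y + c x y"]) metis
qed

lemma quadratic_form_cmult:
  assumes "quadratic_form f"
  shows "quadratic_form (\<lambda>x. k * f x)"
proof -
  obtain b where b: "bilinear b" "\<And>x y. b x y = b y x" "\<And>x. f x = b x x"
    using assms unfolding quadratic_form_def by metis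
  have "bilinear (\<lambda>x y. k * b x y)"
    unfolding bilinear_def
    by (auto intro!: linearI simp: bilinear_ladd[OF b(1)] bilinear_radd[OF b(1)]
        bilinear_lmul[OF b(1)] bilinear_rmul[OF b(1)] distrib_left)
  then show ?thesis
    unfolding quadratic_form_def using b(2,3)
    by (intro exI[of _ "\<lambda>x y. k * b x y"]) metis
qed

lemma quadratic_form_diff:
  assumes "quadratic_form f" "quadratic_form g"
  shows "quadratic_form (\<lambda>x. f x - g x)"
  using quadratic_form_add[OF assms(1) quadratic_form_cmult[OF assms(2), of "-1"]] by simp

lemma quadratic_form_compose:
  assumes "quadratic_form f" "bounded_linear l"
  shows "quadratic_form (\<lambda>x. f (l x))"
proof -
  obtain b where b: "bilinear b" "\<And>x y. b x y = b y x" "\<And>x. f x = b x x"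
    using assms unfolding quadratic_form_def by metis
  have "linear l"
    using assms(2) by (rule bounded_linear.linear)
  then have "bilinear (\<lambda>x y. b (l x) (l y))"
    using bilinear_compose[OF b(1)] by blast
  then show ?thesis
    unfolding quadratic_form_def using b(2,3)
    by (intro exI[of _ "\<lambda>x y. b (l x) (l y)"]) metis
qed

lemma quadratic_form_scaleR:
  assumes "quadratic_form f"
  shows "f (k *\<^sub>R x) = k\<^sup>2 * f x"
  using assms unfolding quadratic_form_def
  by (auto simp: bilinear_lmul bilinear_rmul power2_eq_square)

lemma quadratic_form_zero: "quadratic_form f \<Longrightarrow> f 0 = 0"
  using quadratic_form_scaleR[of f 0 0] by simp

lemma continuous_on_quadratic_form:
  assumes "quadratic_form f"
  shows "continuous_on S f"
proof -
  obtain b where b: "bilinear b" "\<And>x. f x = b x x"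
    using assms unfolding quadratic_form_def by metis
  interpret bounded_bilinear b
    using b(1) bilinear_conv_bounded_bilinear by blast
  have "continuous_on S (\<lambda>x. b x x)"
    by (intro continuous_on continuous_on_id)
  then show ?thesis
    using b(2) by presburger
qed

text \<open>Riesz representation, by expanding the first argument in the orthonormal basis. It
  yields linear operators that can be inverted or turned into matrices.\<close>

lemma bilinear_eq_inner_linear:
  fixes b :: "'a::euclidean_space \<Rightarrow> 'b::euclidean_space \<Rightarrow> real"
  assumes "bilinear b"
  obtains N where "linear N" "\<And>x y. b x y = x \<bullet> N y"
proof
  let ?N = "\<lambda>y. \<Sum>e\<in>Basis. b e y *\<^sub>R e"
  show "linear ?N"
    by (rule linearI) (simp_all add: bilinear_radd[OF assms] bilinear_rmul[OF assms]
        scaleR_add_left sum.distrib scaleR_sum_right)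
  fix x y
  have lin: "linear (\<lambda>x. b x y)"
    using assms by (simp add: bilinear_def)
  have "b x y = b (\<Sum>e\<in>Basis. (x \<bullet> e) *\<^sub>R e) y"
    by (simp add: euclidean_representation)
  also have "\<dots> = (\<Sum>e\<in>Basis. (x \<bullet> e) * b e y)"
    by (simp add: linear_sum[OF lin] bilinear_lmul[OF assms])
  also have "\<dots> = x \<bullet> ?N y"
    by (simp add: inner_sum_right mult.commute)
  finally show "b x y = x \<bullet> ?N y" .
qed

subsection \<open>Finsler's lemma and separation\<close>

text \<open>On the compact part of the unit sphere where \<open>f\<close> is nonnegative,
  \<open>g\<close> has a positive minimum, so a large multiple of \<open>g\<close> exceeds
  \<open>f\<close> there. Both forms are homogeneous of degree two, which carries the inequality to
  all nonzero vectors.\<close>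

lemma finsler:
  fixes f g :: "'a::euclidean_space \<Rightarrow> real"
  assumes f: "quadratic_form f" and g: "quadratic_form g" and g_nonneg: "\<And>x. 0 \<le> g x"
    and neg: "\<And>x. x \<noteq> 0 \<Longrightarrow> g x = 0 \<Longrightarrow> f x < 0"
  obtains M where "\<And>x. x \<noteq> 0 \<Longrightarrow> f x - M * g x < 0"
proof -
  define K where "K = {x \<in> sphere 0 1. 0 \<le> f x}"
  have "K = sphere 0 1 \<inter> f -` {0..}"
    unfolding K_def by auto
  then have K: "compact K"
    using continuous_closed_preimage[OF continuous_on_quadratic_form[OF f], of "sphere 0 1" "{0..}"]
    by (metis closed_atLeast closed_sphere bounded_sphere bounded_Int compact_eq_bounded_closed)
  \<comment> \<open>The sign of \<open>M\<close> matters off \<open>K\<close>: there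
    \<open>f\<close> is already negative, and subtracting \<open>M * g\<close> must not spoil
    this.\<close>
  have "\<exists>M. 0 \<le> M \<and> (\<forall>x\<in>K. f x < M * g x)"
  proof (cases "K = {}")
    case False
    obtain a where a: "a \<in> K" "\<And>x. x \<in> K \<Longrightarrow> g a \<le> g x"
      using continuous_attains_inf[OF K False continuous_on_quadratic_form[OF g]] by blast
    obtain c where c: "c \<in> K" "\<And>x. x \<in> K \<Longrightarrow> f x \<le> f c"
      using continuous_attains_sup[OF K False continuous_on_quadratic_form[OF f]] by blast
    have "a \<noteq> 0" "0 \<le> f a"
      using a(1) by (auto simp: K_def)
    then have "g a \<noteq> 0"
      using neg[of a] by auto
    then have pos: "0 < g a"
      using g_nonneg[of a] by linarith
    have fc: "0 \<le> f c"
      using c(1) by (simp add: K_def)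
    \<comment> \<open>The factor compares the maximum of \<open>f\<close> on \<open>K\<close> with
      the minimum of \<open>g\<close>; adding 1 makes the inequality strict.\<close>
    have "f x < ((f c + 1) / g a) * g x" if "x \<in> K" for x
    proof -
      have "f x < ((f c + 1) / g a) * g a"
        using c(2)[OF that] pos by simp
      also have "\<dots> \<le> ((f c + 1) / g a) * g x"
        using a(2)[OF that] pos fc by (intro mult_left_mono) auto
      finally show ?thesis .
    qed
    then show ?thesis
      using pos fc by (intro exI[of _ "(f c + 1) / g a"]) auto
  qed auto
  then obtain M where M: "0 \<le> M" "\<And>x. x \<in> K \<Longrightarrow> f x < M * g x"
    by blast
  show ?thesis
  proof
    fix x :: 'a
    assume "x \<noteq> 0"
    define u where "u = x /\<^sub>R norm x"
    have x: "x = norm x *\<^sub>R u" and u: "norm u = 1"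
      using \<open>x \<noteq> 0\<close> by (simp_all add: u_def)
    have "f u - M * g u < 0"
    proof (cases "u \<in> K")
      case False
      then have "f u < 0"
        using u by (auto simp: K_def)
      then show ?thesis
        using mult_nonneg_nonneg[OF M(1) g_nonneg[of u]] by linarith
    qed (use M(2) in force)
    moreover have "f x - M * g x = (norm x)\<^sup>2 * (f u - M * g u)"
      using quadratic_form_scaleR[OF f, of "norm x" u] quadratic_form_scaleR[OF g, of "norm x" u]
      by (metis x mult.left_commute right_diff_distrib)
    ultimately show "f x - M * g x < 0"
      using \<open>x \<noteq> 0\<close> by (simp add: mult_pos_neg)
  qed
qed

text \<open>Completing the square in \<open>y\<close>: the maximizer \<open>T u\<close> depends
  linearly on \<open>u\<close>, so \<open>h (T u, u)\<close> is again a quadratic form in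
  \<open>u\<close>.\<close>

lemma quadratic_form_partial_max:
  fixes h :: "'a::euclidean_space \<times> 'b::euclidean_space \<Rightarrow> real"
  assumes h: "quadratic_form h" and neg: "\<And>y. y \<noteq> 0 \<Longrightarrow> h (y, 0) < 0"
  obtains T where "bounded_linear T" "\<And>y u. h (y, u) \<le> h (T u, u)"
proof -
  obtain b where b: "bilinear b" "\<And>x y. b x y = b y x" "\<And>x. h x = b x x"
    using h unfolding quadratic_form_def by metis
  have lin: "linear (\<lambda>y :: 'a. (y, 0 :: 'b))" "linear (\<lambda>u :: 'b. (0 :: 'a, u))"
    by (auto intro!: linearI)
  obtain N where N: "linear N" "\<And>x y. b (x, 0) (y, 0) = x \<bullet> N y"
    using bilinear_eq_inner_linear[OF bilinear_compose[OF b(1) lin(1) lin(1)]] by blast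
  obtain L where L: "linear L" "\<And>x u. b (x, 0) (0, u) = x \<bullet> L u"
    using bilinear_eq_inner_linear[OF bilinear_compose[OF b(1) lin(1) lin(2)]] by blast
  \<comment> \<open>Here \<open>y \<bullet> N y\<close> equals \<open>h (y, 0)\<close>, so a nonzero
    kernel vector would contradict \<open>neg\<close>. In finite dimension \<open>N\<close> is then
    also surjective, and its right inverse solves \<open>N y = - L u\<close>.\<close>
  have "y = 0" if "N y = 0" for y
    using neg[of y] N(2)[of y y] that b(3) by fastforce
  then have "inj N"
    using N(1) linear_injective_0 by blast
  then have "surj N"
    using N(1) linear_injective_imp_surjective by blast
  then obtain J where J: "linear J" "N \<circ> J = id"
    using linear_surjective_right_inverse[OF N(1)] by blast
  define T where "T u = - J (L u)" for u
  have "linear T"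
    unfolding T_def using linear_compose[OF L(1) J(1)]
    by (simp add: comp_def linear_compose_neg)
  \<comment> \<open>\<open>(T u, u)\<close> is orthogonal to \<open>(y, 0)\<close>: \<open>T u\<close> is the critical point of \<open>h (_, u)\<close>.\<close>
  have orth: "b (y, 0) (T u, u) = 0" for y u
  proof -
    have "b (y, 0) (T u, u) = b (y, 0) (T u, 0) + b (y, 0) (0, u)"
      using bilinear_radd[OF b(1), of "(y, 0)" "(T u, 0)" "(0, u)"] by simp
    also have "\<dots> = y \<bullet> (N (T u) + L u)"
      by (simp add: N(2) L(2) inner_add_right)
    also have "N (T u) = - L u"
      using fun_cong[OF J(2), of "L u"] by (simp add: T_def linear_neg[OF N(1)])
    finally show ?thesis by simp
  qed
  have "h (y, u) \<le> h (T u, u)" for y u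
  proof -
    \<comment> \<open>Split \<open>(y, u)\<close> into two \<open>b\<close>-orthogonal parts: the
      cross terms vanish and the deviation from \<open>T u\<close> contributes at most 0.\<close>
    let ?p = "(y - T u, 0)" and ?q = "(T u, u)"
    have "h (y, u) = b (?p + ?q) (?p + ?q)"
      using b(3) by simp
    also have "\<dots> = b ?p ?p + b ?p ?q + (b ?q ?p + b ?q ?q)"
      by (simp only: bilinear_ladd[OF b(1)] bilinear_radd[OF b(1)])
    also have "\<dots> = h ?p + h ?q"
      using orth[of "y - T u" u] b(2)[of ?q ?p] b(3) by simp
    also have "h ?p \<le> 0"
      using neg[of "y - T u"] quadratic_form_zero[OF h]
      by (cases "y - T u = 0") (auto simp: zero_prod_def)
    finally show ?thesis by simp
  qed
  then show thesis
    using that \<open>linear T\<close> linear_conv_bounded_linear by blast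
qed

text \<open>For fixed \<open>u\<close> the variables \<open>y1\<close> and \<open>y2\<close> are
  independent, so both can be maximized at once. The maximum of \<open>h1\<close> then lies below
  minus the maximum of \<open>h2\<close>, and a quadratic form fits between them.\<close>

lemma quadratic_form_separation:
  fixes h1 :: "'a::euclidean_space \<times> 'c::euclidean_space \<Rightarrow> real"
    and h2 :: "'b::euclidean_space \<times> 'c \<Rightarrow> real"
  assumes h1: "quadratic_form h1" and h2: "quadratic_form h2"
    and neg: "\<And>y1 y2 u. (y1, y2, u) \<noteq> 0 \<Longrightarrow> h1 (y1, u) + h2 (y2, u) < 0"
  obtains q where "quadratic_form q"
    "\<And>y u. (y, u) \<noteq> 0 \<Longrightarrow> h1 (y, u) < q u" "\<And>y u. (y, u) \<noteq> 0 \<Longrightarrow> h2 (y, u) < - q u"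
proof -
  have h0: "h1 (0, 0) = 0" "h2 (0, 0) = 0"
    using quadratic_form_zero[OF h1] quadratic_form_zero[OF h2] by (simp_all add: zero_prod_def)
  have neg1: "h1 (y, 0) < 0" if "y \<noteq> 0" for y
    using neg[of y 0 0] h0 that by (simp add: zero_prod_def)
  have neg2: "h2 (y, 0) < 0" if "y \<noteq> 0" for y
    using neg[of 0 y 0] h0 that by (simp add: zero_prod_def)
  obtain T1 where T1: "bounded_linear T1" "\<And>y u. h1 (y, u) \<le> h1 (T1 u, u)"
    using quadratic_form_partial_max[OF h1 neg1] by blast
  obtain T2 where T2: "bounded_linear T2" "\<And>y u. h2 (y, u) \<le> h2 (T2 u, u)"
    using quadratic_form_partial_max[OF h2 neg2] by blast
  \<comment> \<open>The midpoint between the maximum of \<open>h1\<close> and minus the maximum of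
    \<open>h2\<close>.\<close>
  define q where "q u = (1 / 2) * (h1 (T1 u, u) - h2 (T2 u, u))" for u
  have q: "quadratic_form q"
    unfolding q_def
    by (intro quadratic_form_cmult quadratic_form_diff quadratic_form_compose[OF h1]
        quadratic_form_compose[OF h2] bounded_linear_Pair T1(1) T2(1) bounded_linear_ident)
  have q2: "2 * q u = h1 (T1 u, u) - h2 (T2 u, u)" for u
    by (simp add: q_def)
  have sum: "h1 (T1 u, u) + h2 (T2 u, u) < 0" if "u \<noteq> 0" for u
    using neg[of "T1 u" "T2 u" u] that by (simp add: zero_prod_def)
  show thesis
  proof
    show "quadratic_form q" by (rule q)
    fix u
    show "h1 (y, u) < q u" if "(y, u) \<noteq> 0" for y
    \<comment> \<open>At \<open>u = 0\<close> the gap between the two bounds closes, and strictness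
      comes instead from \<open>y \<noteq> 0\<close>.\<close>
    proof (cases "u = 0")
      case True
      then show ?thesis
        using neg1[of y] that quadratic_form_zero[OF q] by (auto simp: zero_prod_def)
    next
      case False
      then show ?thesis
        using sum[OF False] T1(2)[of y u] q2[of u] by linarith
    qed
    show "h2 (y, u) < - q u" if "(y, u) \<noteq> 0" for y
    proof (cases "u = 0")
      case True
      then show ?thesis
        using neg2[of y] that quadratic_form_zero[OF q] by (auto simp: zero_prod_def)
    next
      case False
      then show ?thesis
        using sum[OF False] T2(2)[of y u] q2[of u] by linarith
    qed
  qed
qed

lemma interconnection_separation:
  fixes g1 :: "'a::euclidean_space \<times> 'v::euclidean_space \<Rightarrow> real"
    and g2 :: "'b::euclidean_space \<times> 'w::euclidean_space \<Rightarrow> real"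
    and c1 :: "'a \<Rightarrow> 'w" and c2 :: "'b \<Rightarrow> 'v"
  assumes g1: "quadratic_form g1" and g2: "quadratic_form g2"
    and c1: "bounded_linear c1" and c2: "bounded_linear c2"
    and neg: "\<And>y1 y2. (y1, y2) \<noteq> 0 \<Longrightarrow> g1 (y1, c2 y2) + g2 (y2, c1 y1) < 0"
  obtains q where "quadratic_form q"
    "\<And>y v. (y, v) \<noteq> 0 \<Longrightarrow> g1 (y, v) < q (v, c1 y)"
    "\<And>y w. (y, w) \<noteq> 0 \<Longrightarrow> g2 (y, w) < - q (c2 y, w)"
proof -
  note linear_rules = bounded_linear_Pair bounded_linear_sub bounded_linear_ident
    bounded_linear_fst_comp bounded_linear_snd_comp
    bounded_linear_compose[OF c1] bounded_linear_compose[OF c2]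
  define f :: "'a \<times> 'b \<times> 'v \<times> 'w \<Rightarrow> real"
    where "f = (\<lambda>(y1, y2, v, w). g1 (y1, v) + g2 (y2, w))"
  \<comment> \<open>The squared mismatch of the coupling signals, which vanishes exactly on the
    interconnection subspace.\<close>
  define g :: "'a \<times> 'b \<times> 'v \<times> 'w \<Rightarrow> real"
    where "g = (\<lambda>(y1, y2, v, w). (w - c1 y1) \<bullet> (w - c1 y1) + (v - c2 y2) \<bullet> (v - c2 y2))"
  have f: "quadratic_form f"
    unfolding f_def case_prod_unfold
    by (intro quadratic_form_add quadratic_form_compose[OF g1] quadratic_form_compose[OF g2]
        linear_rules)
  have g: "quadratic_form g"
    unfolding g_def case_prod_unfold
    by (intro quadratic_form_add quadratic_form_inner linear_rules)
  have "0 \<le> g x" for x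
    by (simp add: g_def split: prod.split)
  moreover have "f x < 0" if "x \<noteq> 0" "g x = 0" for x
  proof -
    obtain y1 y2 v w where x: "x = (y1, y2, v, w)"
      by (cases x) auto
    have "w = c1 y1 \<and> v = c2 y2"
      using that(2) by (simp add: g_def x add_nonneg_eq_0_iff)
    \<comment> \<open>If \<open>y1\<close> and \<open>y2\<close> vanished, so would
      \<open>w = c1 y1\<close> and \<open>v = c2 y2\<close>, hence all of \<open>x\<close>.\<close>
    moreover have "(y1, y2) \<noteq> 0"
      using calculation that(1) c1 c2 by (auto simp: x zero_prod_def linear_simps)
    ultimately show ?thesis
      using neg by (simp add: f_def x)
  qed
  ultimately obtain M where M: "\<And>x. x \<noteq> 0 \<Longrightarrow> f x - M * g x < 0"
    using finsler[OF f g] by blast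
  \<comment> \<open>Each penalty term goes to the subsystem whose variable it contains. Then
    \<open>h1\<close> and \<open>h2\<close> share only \<open>u = (v, w)\<close>, and their sum is
    \<open>f - M * g\<close>.\<close>
  define h1 where "h1 = (\<lambda>(y, v, w). g1 (y, v) - M * ((w - c1 y) \<bullet> (w - c1 y)))"
  define h2 where "h2 = (\<lambda>(y, v, w). g2 (y, w) - M * ((v - c2 y) \<bullet> (v - c2 y)))"
  have h1: "quadratic_form h1"
    unfolding h1_def case_prod_unfold
    by (intro quadratic_form_diff quadratic_form_cmult quadratic_form_inner
        quadratic_form_compose[OF g1] linear_rules)
  have h2: "quadratic_form h2"
    unfolding h2_def case_prod_unfold
    by (intro quadratic_form_diff quadratic_form_cmult quadratic_form_inner
        quadratic_form_compose[OF g2] linear_rules)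
  have "h1 (y1, u) + h2 (y2, u) < 0" if "(y1, y2, u) \<noteq> 0" for y1 y2 u
    using M[OF that] by (cases u) (simp add: f_def g_def h1_def h2_def algebra_simps)
  then obtain q where q: "quadratic_form q"
    "\<And>y u. (y, u) \<noteq> 0 \<Longrightarrow> h1 (y, u) < q u" "\<And>y u. (y, u) \<noteq> 0 \<Longrightarrow> h2 (y, u) < - q u"
    using quadratic_form_separation[OF h1 h2] by blast
  show thesis
  proof
    show "quadratic_form q" by (rule q)
    \<comment> \<open>Setting \<open>w = c1 y\<close> removes the penalty from \<open>h1\<close>;
      the next claim does the same with \<open>v = c2 y\<close>.\<close>
    show "g1 (y, v) < q (v, c1 y)" if "(y, v) \<noteq> 0" for y v
      using q(2)[of y "(v, c1 y)"] that by (auto simp: h1_def zero_prod_def)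
    show "g2 (y, w) < - q (c2 y, w)" if "(y, w) \<noteq> 0" for y w
      using q(3)[of y "(c2 y, w)"] that by (auto simp: h2_def zero_prod_def)
  qed
qed

subsection \<open>Block vectors, supply and storage functions\<close>

lemma inner_col: "col a b \<bullet> col c d = a \<bullet> c + b \<bullet> d"
  by (simp add: inner_vec_def col_def sum.Plus flip: UNIV_Plus_UNIV)

lemma col_eq_0_iff: "col a b = 0 \<longleftrightarrow> a = 0 \<and> b = 0"
  using inner_eq_zero_iff[of "col a b"]
  by (simp add: inner_col add_nonneg_eq_0_iff)

lemma col_add: "col a b + col c d = col (a + c) (b + d)"
  by (auto simp: vec_eq_iff col_def split: sum.split)

lemma bounded_linear_matrix_vector_mult:
  fixes M :: "real ^ 'n ^ 'm"
  assumes "bounded_linear f"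
  shows "bounded_linear (\<lambda>x. M *v f x)"
  using bounded_linear_compose[OF matrix_vector_mul_bounded_linear assms] .

lemma quadratic_supply_imp_quadratic_form:
  fixes s :: "real ^ 'd \<Rightarrow> real ^ 'z \<Rightarrow> real"
  assumes "quadratic_supply s"
  shows "quadratic_form (\<lambda>(d, z). s d z)"
proof -
  obtain Q S R where s: "\<And>d z. s d z = col d z \<bullet> (block_matrix Q S (transpose S) R *v col d z)"
    using assms unfolding quadratic_supply_def by metis
  show ?thesis
    unfolding case_prod_unfold s block_matrix_mult inner_col
    by (intro quadratic_form_add quadratic_form_inner bounded_linear_add
        bounded_linear_matrix_vector_mult bounded_linear_fst bounded_linear_snd)
qed

lemma symmetric_matrixI:
  assumes "\<And>x y. x \<bullet> (M *v y) = y \<bullet> (M *v x)"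
  shows "symmetric_matrix M"
proof -
  have "x \<bullet> (transpose M *v y) = x \<bullet> (M *v y)" for x y
    using assms[of x y] by (metis dot_lmul_matrix inner_commute transpose_matrix_vector)
  then show ?thesis
    unfolding symmetric_matrix_def matrix_eq by (metis vector_eq_rdot inner_commute)
qed

lemma symmetric_matrix_inner:
  assumes "symmetric_matrix M"
  shows "x \<bullet> (M *v y) = y \<bullet> (M *v x)"
  using assms unfolding symmetric_matrix_def
  by (metis dot_lmul_matrix inner_commute transpose_matrix_vector)

lemma bilinear_compose_matrix:
  fixes l :: "real ^ 'k \<Rightarrow> 'a::euclidean_space" and m :: "real ^ 'l \<Rightarrow> 'b::euclidean_space"
  assumes "bilinear b" "linear l" "linear m"
  obtains M :: "real ^ 'l ^ 'k" where "\<And>x y. b (l x) (m y) = x \<bullet> (M *v y)"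
proof -
  obtain N where N: "linear N" "\<And>x y. b (l x) (m y) = x \<bullet> N y"
    using bilinear_eq_inner_linear[OF bilinear_compose[OF assms]] by blast
  have "b (l x) (m y) = x \<bullet> (matrix N *v y)" for x y
    using N(2) fun_cong[OF matrix_vector_mul(2)[OF N(1)], of y] by simp
  then show thesis
    by (rule that)
qed

text \<open>Restricting the bilinear form to the two factors gives the blocks. Its symmetry makes
  the diagonal blocks symmetric and the off-diagonal ones transposes of each other.\<close>

lemma quadratic_form_imp_quadratic_supply:
  fixes f :: "(real ^ 'd) \<times> (real ^ 'z) \<Rightarrow> real"
  assumes "quadratic_form f"
  shows "quadratic_supply (\<lambda>d z. f (d, z))"
proof -
  obtain b where b: "bilinear b" "\<And>x y. b x y = b y x" "\<And>x. f x = b x x"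
    using assms unfolding quadratic_form_def by metis
  have lin: "linear (\<lambda>d :: real ^ 'd. (d, 0 :: real ^ 'z))" "linear (\<lambda>z :: real ^ 'z. (0 :: real ^ 'd, z))"
    by (auto intro!: linearI)
  obtain Q where Q: "\<And>x y. b (x, 0) (y, 0) = x \<bullet> (Q *v y)"
    using bilinear_compose_matrix[OF b(1) lin(1) lin(1)] by blast
  obtain S where S: "\<And>x y. b (x, 0) (0, y) = x \<bullet> (S *v y)"
    using bilinear_compose_matrix[OF b(1) lin(1) lin(2)] by blast
  obtain R where R: "\<And>x y. b (0, x) (0, y) = x \<bullet> (R *v y)"
    using bilinear_compose_matrix[OF b(1) lin(2) lin(2)] by blast
  have sym: "symmetric_matrix Q" "symmetric_matrix R"
    using b(2) Q R by (auto intro!: symmetric_matrixI simp flip: Q R)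
  have "f (d, z) = col d z \<bullet> (block_matrix Q S (transpose S) R *v col d z)" for d z
  proof -
    have "f (d, z) = b ((d, 0) + (0, z)) ((d, 0) + (0, z))"
      using b(3) by simp
    also have "\<dots> = b (d, 0) (d, 0) + b (d, 0) (0, z) + (b (0, z) (d, 0) + b (0, z) (0, z))"
      by (simp only: bilinear_ladd[OF b(1)] bilinear_radd[OF b(1)])
    also have "b (0, z) (d, 0) = z \<bullet> (transpose S *v d)"
      using b(2) S by (metis dot_lmul_matrix inner_commute transpose_matrix_vector)
    finally show ?thesis
      by (simp add: Q S R block_matrix_mult inner_col inner_add_right)
  qed
  then show ?thesis
    unfolding quadratic_supply_def using sym by blast
qed

text \<open>By polarization, the matrix of an additive storage function is block diagonal.\<close>

lemma additive_storage_inner: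
  assumes P: "symmetric_matrix P" "\<And>x. V x = x \<bullet> (P *v x)"
    and P1: "symmetric_matrix P1" "\<And>x. V1 x = x \<bullet> (P1 *v x)"
    and P2: "symmetric_matrix P2" "\<And>x. V2 x = x \<bullet> (P2 *v x)"
    and V: "\<And>x1 x2. V (col x1 x2) = V1 x1 + V2 x2"
  shows "col x1 x2 \<bullet> (P *v col y1 y2) = x1 \<bullet> (P1 *v y1) + x2 \<bullet> (P2 *v y2)"
proof -
  have polar: "2 * (x \<bullet> (M *v y)) = W (x + y) - W x - W y"
    if "symmetric_matrix M" "\<And>x. W x = x \<bullet> (M *v x)"
    for M :: "real ^ 'k ^ 'k" and W x y
    using symmetric_matrix_inner[OF that(1), of y x]
    by (simp add: that(2) matrix_vector_right_distrib inner_add_left inner_add_right)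
  show ?thesis
    using polar[OF P, of "col x1 x2" "col y1 y2"] polar[OF P1, of x1 y1] polar[OF P2, of x2 y2]
    by (simp add: V col_add)
qed

text \<open>By symmetry of \<open>P\<close> both summands contribute equally. This identifies the
  Lyapunov matrix inequality with the decrease of the storage function along the flow.\<close>

lemma lyapunov_inner:
  assumes "symmetric_matrix P"
  shows "x \<bullet> ((transpose A ** P + P ** A) *v x) = 2 * (x \<bullet> (P *v (A *v x)))"
proof -
  have "x \<bullet> (transpose A *v (P *v x)) = (A *v x) \<bullet> (P *v x)"
    by (metis dot_lmul_matrix inner_commute transpose_matrix_vector)
  also have "\<dots> = x \<bullet> (P *v (A *v x))"
    using symmetric_matrix_inner[OF assms] .
  finally show ?thesis
    by (simp add: matrix_vector_mult_add_rdistrib inner_add_right flip: matrix_vector_mul_assoc)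
qed

lemma symmetric_block_diag:
  fixes P1 :: "real ^ 'n ^ 'n" and P2 :: "real ^ 'm ^ 'm"
  assumes "symmetric_matrix P1" "symmetric_matrix P2"
  shows "symmetric_matrix (block_matrix P1 0 0 P2)"
proof (rule symmetric_matrixI)
  fix x y :: "real ^ ('n + 'm)"
  obtain x1 x2 y1 y2 where "x = col x1 x2" "y = col y1 y2"
    by (metis col_upper_lower)
  then show "x \<bullet> (block_matrix P1 0 0 P2 *v y) = y \<bullet> (block_matrix P1 0 0 P2 *v x)"
    using symmetric_matrix_inner[OF assms(1), of x1 y1] symmetric_matrix_inner[OF assms(2), of x2 y2]
    by (simp add: block_matrix_mult inner_col)
qed

text \<open>Translates from nested pairs to stacked vectors. The pair \<open>(x, d)\<close> collects
  the local variables that are maximized out, while \<open>v\<close> is the coupling input; the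
  external supply moves to the right-hand side.\<close>

lemma strictly_dissipative_supply_split:
  fixes B :: "real ^ 'v ^ 'n" and E :: "real ^ 'd ^ 'n"
    and C :: "real ^ 'n ^ 'w" and F :: "real ^ 'n ^ 'z"
    and s :: "real ^ 'd \<Rightarrow> real ^ 'z \<Rightarrow> real"
  assumes P: "symmetric_matrix P" "\<And>x. V x = x \<bullet> (P *v x)"
    and ineq: "\<And>x d v. ((x, d), v) \<noteq> 0 \<Longrightarrow>
      2 * (x \<bullet> (P *v (A *v x + B *v v + E *v d))) - s d (F *v x) < i v (C *v x)"
  shows "strictly_dissipative A (hstack B E) (vstack C F) 0
    (\<lambda>u y. s (lower u) (lower y) + i (upper u) (upper y)) V"
  unfolding strictly_dissipative_def
proof (intro exI[of _ P] conjI allI impI)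
  fix x :: "real ^ 'n" and u :: "real ^ ('v + 'd)"
  assume nz: "(x, u) \<noteq> (0, 0)"
  obtain v d where u: "u = col v d"
    by (metis col_upper_lower)
  have "((x, d), v) \<noteq> 0"
    using nz by (auto simp: u col_eq_0_iff zero_prod_def)
  from ineq[OF this]
  show "2 * (x \<bullet> (P *v (A *v x + hstack B E *v u)))
      < s (lower u) (lower (vstack C F *v x + 0 *v u))
        + i (upper u) (upper (vstack C F *v x + 0 *v u))"
    by (simp add: u hstack_mult vstack_mult add.assoc)
qed (use P in auto)

section \<open>Internal supply functions of two coupled systems\<close>

text \<open>Common core of the cases with and without external channels: \<open>y\<close> is the
  state together with the external input, or the state alone. Taking
  \<open>s1 v w = q (v, w)\<close> and \<open>s2 w v = - q (v, w)\<close> makes the supplies cancel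
  identically.\<close>

lemma internal_supplies:
  fixes g1 :: "'a::euclidean_space \<times> (real ^ 'v) \<Rightarrow> real"
    and g2 :: "'b::euclidean_space \<times> (real ^ 'w) \<Rightarrow> real"
    and c1 :: "'a \<Rightarrow> real ^ 'w" and c2 :: "'b \<Rightarrow> real ^ 'v"
  assumes g1: "quadratic_form g1" "\<And>v. g1 (0, v) = 0"
    and g2: "quadratic_form g2" "\<And>w. g2 (0, w) = 0"
    and c1: "bounded_linear c1" and c2: "bounded_linear c2"
    and neg: "\<And>y1 y2. (y1, y2) \<noteq> 0 \<Longrightarrow> g1 (y1, c2 y2) + g2 (y2, c1 y1) < 0"
  obtains s1 s2 where "quadratic_supply s1" "quadratic_supply s2"
    "\<And>v w. s1 v w + s2 w v = 0"
    "\<And>y v. (y, v) \<noteq> 0 \<Longrightarrow> g1 (y, v) < s1 v (c1 y)"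
    "\<And>y w. (y, w) \<noteq> 0 \<Longrightarrow> g2 (y, w) < s2 w (c2 y)"
    "\<And>w. w \<noteq> 0 \<Longrightarrow> s1 0 w \<le> 0" "\<And>v. v \<noteq> 0 \<Longrightarrow> s2 0 v \<le> 0"
proof -
  obtain q where q: "quadratic_form q"
    "\<And>y v. (y, v) \<noteq> 0 \<Longrightarrow> g1 (y, v) < q (v, c1 y)"
    "\<And>y w. (y, w) \<noteq> 0 \<Longrightarrow> g2 (y, w) < - q (c2 y, w)"
    using interconnection_separation[OF g1(1) g2(1) c1 c2 neg] by blast
  have "quadratic_form (\<lambda>x. (- 1) * q (snd x, fst x))"
    by (intro quadratic_form_cmult quadratic_form_compose[OF q(1)] bounded_linear_Pair
        bounded_linear_fst bounded_linear_snd)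
  from quadratic_form_imp_quadratic_supply[OF this]
  have swap: "quadratic_supply (\<lambda>w v. - q (v, w))"
    by simp
  show thesis
  proof
    show "quadratic_supply (\<lambda>v w. q (v, w))"
      by (rule quadratic_form_imp_quadratic_supply[OF q(1)])
    \<comment> \<open>The sign of each supply comes from the other subsystem: at
      \<open>y = 0\<close> its output and its \<open>g\<close> vanish, leaving
      \<open>0 < - q (0, w)\<close>. The next claim is symmetric.\<close>
    show "q (0, w) \<le> 0" if "w \<noteq> 0" for w
      using q(3)[of 0 w] g2(2)[of w] that c2 by (simp add: zero_prod_def linear_simps)
    show "- q (v, 0) \<le> 0" if "v \<noteq> 0" for v
      using q(2)[of 0 v] g1(2)[of v] that c1 by (simp add: zero_prod_def linear_simps)
  qed (use swap q in auto)
qed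

theorem proposition5p2:
  fixes A1 :: "real ^ 'n1 ^ 'n1" and B1 :: "real ^ 'p2 ^ 'n1" and C1 :: "real ^ 'n1 ^ 'p1"
    and E1 :: "real ^ 'm1 ^ 'n1" and F1 :: "real ^ 'n1 ^ 'q1"
    and A2 :: "real ^ 'n2 ^ 'n2" and B2 :: "real ^ 'p1 ^ 'n2" and C2 :: "real ^ 'n2 ^ 'p2"
    and E2 :: "real ^ 'm2 ^ 'n2" and F2 :: "real ^ 'n2 ^ 'q2"
    and s_ext :: "real ^ ('m1 + 'm2) \<Rightarrow> real ^ ('q1 + 'q2) \<Rightarrow> real"
    and s1_ext :: "real ^ 'm1 \<Rightarrow> real ^ 'q1 \<Rightarrow> real"
    and s2_ext :: "real ^ 'm2 \<Rightarrow> real ^ 'q2 \<Rightarrow> real"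
    and V :: "real ^ ('n1 + 'n2) \<Rightarrow> real"
    and V1 :: "real ^ 'n1 \<Rightarrow> real" and V2 :: "real ^ 'n2 \<Rightarrow> real"
  shows
    "(quadratic_supply s_ext \<and> quadratic_supply s1_ext \<and> quadratic_supply s2_ext \<and>
      (\<forall>d1 d2 z1 z2. s_ext (col d1 d2) (col z1 z2) = s1_ext d1 z1 + s2_ext d2 z2) \<and>
      quadratic_storage V1 \<and> quadratic_storage V2 \<and>
      (\<forall>x1 x2. V (col x1 x2) = V1 x1 + V2 x2) \<and>
      strictly_dissipative (coupled_matrix A1 B1 C1 A2 B2 C2) (block_matrix E1 0 0 E2)
        (block_matrix F1 0 0 F2) 0 s_ext V
      \<longrightarrow>
      (\<exists>(s1_int :: real ^ 'p2 \<Rightarrow> real ^ 'p1 \<Rightarrow> real) (s2_int :: real ^ 'p1 \<Rightarrow> real ^ 'p2 \<Rightarrow> real).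
        quadratic_supply s1_int \<and> quadratic_supply s2_int \<and>
        (\<forall>v1 w1 v2 w2. v1 = w2 \<and> v2 = w1 \<longrightarrow> s1_int v1 w1 + s2_int v2 w2 = 0) \<and>
        strictly_dissipative A1 (hstack B1 E1) (vstack C1 F1) 0
          (\<lambda>u y. s1_ext (lower u) (lower y) + s1_int (upper u) (upper y)) V1 \<and>
        strictly_dissipative A2 (hstack B2 E2) (vstack C2 F2) 0
          (\<lambda>u y. s2_ext (lower u) (lower y) + s2_int (upper u) (upper y)) V2 \<and>
        (\<forall>w1. w1 \<noteq> 0 \<longrightarrow> s1_int 0 w1 \<le> 0) \<and> (\<forall>w2. w2 \<noteq> 0 \<longrightarrow> s2_int 0 w2 \<le> 0)))
     \<and>
     (asymptotically_stable (coupled_matrix A1 B1 C1 A2 B2 C2) \<and>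
      additive_quadratic_lyapunov (coupled_matrix A1 B1 C1 A2 B2 C2) V1 V2
      \<longrightarrow>
      (\<exists>(s1_int :: real ^ 'p2 \<Rightarrow> real ^ 'p1 \<Rightarrow> real) (s2_int :: real ^ 'p1 \<Rightarrow> real ^ 'p2 \<Rightarrow> real).
        quadratic_supply s1_int \<and> quadratic_supply s2_int \<and>
        (\<forall>v1 w1 v2 w2. v1 = w2 \<and> v2 = w1 \<longrightarrow> s1_int v1 w1 + s2_int v2 w2 = 0) \<and>
        strictly_dissipative A1 B1 C1 0 s1_int V1 \<and>
        strictly_dissipative A2 B2 C2 0 s2_int V2 \<and>
        (\<forall>w1. w1 \<noteq> 0 \<longrightarrow> s1_int 0 w1 \<le> 0) \<and> (\<forall>w2. w2 \<noteq> 0 \<longrightarrow> s2_int 0 w2 \<le> 0)))"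
proof (rule conjI; rule impI)
  assume "quadratic_supply s_ext \<and> quadratic_supply s1_ext \<and> quadratic_supply s2_ext \<and>
      (\<forall>d1 d2 z1 z2. s_ext (col d1 d2) (col z1 z2) = s1_ext d1 z1 + s2_ext d2 z2) \<and>
      quadratic_storage V1 \<and> quadratic_storage V2 \<and>
      (\<forall>x1 x2. V (col x1 x2) = V1 x1 + V2 x2) \<and>
      strictly_dissipative (coupled_matrix A1 B1 C1 A2 B2 C2) (block_matrix E1 0 0 E2)
        (block_matrix F1 0 0 F2) 0 s_ext V"
  then have s: "quadratic_supply s1_ext" "quadratic_supply s2_ext"
    and s_ext: "\<And>d1 d2 z1 z2. s_ext (col d1 d2) (col z1 z2) = s1_ext d1 z1 + s2_ext d2 z2"
    and storage: "quadratic_storage V1" "quadratic_storage V2"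
    and V: "\<And>x1 x2. V (col x1 x2) = V1 x1 + V2 x2"
    and diss: "strictly_dissipative (coupled_matrix A1 B1 C1 A2 B2 C2) (block_matrix E1 0 0 E2)
        (block_matrix F1 0 0 F2) 0 s_ext V"
    by blast+
  obtain P1 where P1: "symmetric_matrix P1" "\<And>x. V1 x = x \<bullet> (P1 *v x)"
    using storage(1) unfolding quadratic_storage_def by blast
  obtain P2 where P2: "symmetric_matrix P2" "\<And>x. V2 x = x \<bullet> (P2 *v x)"
    using storage(2) unfolding quadratic_storage_def by blast
  obtain P where P: "symmetric_matrix P" "\<And>x. V x = x \<bullet> (P *v x)"
    and ineq: "\<And>x d. (x, d) \<noteq> (0, 0) \<Longrightarrow>
      2 * (x \<bullet> (P *v (coupled_matrix A1 B1 C1 A2 B2 C2 *v x + block_matrix E1 0 0 E2 *v d)))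
        < s_ext d (block_matrix F1 0 0 F2 *v x + 0 *v d)"
    using diss unfolding strictly_dissipative_def by metis
  define g1 :: "((real ^ 'n1) \<times> (real ^ 'm1)) \<times> (real ^ 'p2) \<Rightarrow> real"
    where "g1 = (\<lambda>((x, d), v).
      2 * (x \<bullet> (P1 *v (A1 *v x + B1 *v v + E1 *v d))) - s1_ext d (F1 *v x))"
  define g2 :: "((real ^ 'n2) \<times> (real ^ 'm2)) \<times> (real ^ 'p1) \<Rightarrow> real"
    where "g2 = (\<lambda>((x, d), v).
      2 * (x \<bullet> (P2 *v (A2 *v x + B2 *v v + E2 *v d))) - s2_ext d (F2 *v x))"
  note linear_rules = bounded_linear_add bounded_linear_matrix_vector_mult bounded_linear_ident
    bounded_linear_Pair bounded_linear_fst_comp bounded_linear_snd_comp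
  note s_form = s[THEN quadratic_supply_imp_quadratic_form]
  \<comment> \<open>The external supply is a form in \<open>(d, z)\<close>; composing it with the
    linear map to \<open>(d, F1 *v x)\<close> makes it a form in the variables of
    \<open>g1\<close>.\<close>
  have s1_form: "quadratic_form (\<lambda>x :: ((real ^ 'n1) \<times> (real ^ 'm1)) \<times> (real ^ 'p2).
      s1_ext (snd (fst x)) (F1 *v fst (fst x)))"
    using quadratic_form_compose[OF s_form(1),
        of "\<lambda>x :: ((real ^ 'n1) \<times> (real ^ 'm1)) \<times> (real ^ 'p2). (snd (fst x), F1 *v fst (fst x))"]
    by (simp add: linear_rules)
  have s2_form: "quadratic_form (\<lambda>x :: ((real ^ 'n2) \<times> (real ^ 'm2)) \<times> (real ^ 'p1).
      s2_ext (snd (fst x)) (F2 *v fst (fst x)))"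
    using quadratic_form_compose[OF s_form(2),
        of "\<lambda>x :: ((real ^ 'n2) \<times> (real ^ 'm2)) \<times> (real ^ 'p1). (snd (fst x), F2 *v fst (fst x))"]
    by (simp add: linear_rules)
  have g1: "quadratic_form g1"
    unfolding g1_def case_prod_unfold
    by (intro quadratic_form_diff quadratic_form_cmult quadratic_form_inner s1_form linear_rules)
  have g2: "quadratic_form g2"
    unfolding g2_def case_prod_unfold
    by (intro quadratic_form_diff quadratic_form_cmult quadratic_form_inner s2_form linear_rules)
  have zero: "g1 (0, v) = 0" "g2 (0, w) = 0" for v w
    using s_form[THEN quadratic_form_zero] by (simp_all add: g1_def g2_def zero_prod_def)
  have neg: "g1 (y1, C2 *v fst y2) + g2 (y2, C1 *v fst y1) < 0" if "(y1, y2) \<noteq> 0" for y1 y2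
  proof -
    obtain x1 d1 x2 d2 where y: "y1 = (x1, d1)" "y2 = (x2, d2)"
      by (metis surj_pair)
    have "(col x1 x2, col d1 d2) \<noteq> (0, 0)"
      using that by (auto simp: y col_eq_0_iff zero_prod_def)
    from ineq[OF this] show ?thesis
      \<comment> \<open>Additivity of the storage and of the external supply splits the dissipation
        inequality of the coupled system into the two local terms.\<close>
      by (simp add: y g1_def g2_def coupled_matrix_mult block_matrix_mult col_add s_ext
          additive_storage_inner[OF P P1 P2 V])
  qed
  have outputs: "bounded_linear (\<lambda>y :: (real ^ 'n1) \<times> (real ^ 'm1). C1 *v fst y)"
    "bounded_linear (\<lambda>y :: (real ^ 'n2) \<times> (real ^ 'm2). C2 *v fst y)"
    by (intro linear_rules)+
  obtain s1_int s2_int where int: "quadratic_supply s1_int" "quadratic_supply s2_int"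
    "\<And>v w. s1_int v w + s2_int w v = 0"
    "\<And>y v. (y, v) \<noteq> 0 \<Longrightarrow> g1 (y, v) < s1_int v (C1 *v fst y)"
    "\<And>y w. (y, w) \<noteq> 0 \<Longrightarrow> g2 (y, w) < s2_int w (C2 *v fst y)"
    "\<And>w. w \<noteq> 0 \<Longrightarrow> s1_int 0 w \<le> 0" "\<And>v. v \<noteq> 0 \<Longrightarrow> s2_int 0 v \<le> 0"
    using internal_supplies[OF g1 zero(1) g2 zero(2) outputs neg] by blast
  have "strictly_dissipative A1 (hstack B1 E1) (vstack C1 F1) 0
      (\<lambda>u y. s1_ext (lower u) (lower y) + s1_int (upper u) (upper y)) V1"
    by (rule strictly_dissipative_supply_split[OF P1])
      (use int(4) in \<open>fastforce simp: g1_def\<close>)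
  moreover have "strictly_dissipative A2 (hstack B2 E2) (vstack C2 F2) 0
      (\<lambda>u y. s2_ext (lower u) (lower y) + s2_int (upper u) (upper y)) V2"
    by (rule strictly_dissipative_supply_split[OF P2])
      (use int(5) in \<open>fastforce simp: g2_def\<close>)
  ultimately show "\<exists>(s1_int :: real ^ 'p2 \<Rightarrow> real ^ 'p1 \<Rightarrow> real) (s2_int :: real ^ 'p1 \<Rightarrow> real ^ 'p2 \<Rightarrow> real).
      quadratic_supply s1_int \<and> quadratic_supply s2_int \<and>
      (\<forall>v1 w1 v2 w2. v1 = w2 \<and> v2 = w1 \<longrightarrow> s1_int v1 w1 + s2_int v2 w2 = 0) \<and>
      strictly_dissipative A1 (hstack B1 E1) (vstack C1 F1) 0
        (\<lambda>u y. s1_ext (lower u) (lower y) + s1_int (upper u) (upper y)) V1 \<and>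
      strictly_dissipative A2 (hstack B2 E2) (vstack C2 F2) 0
        (\<lambda>u y. s2_ext (lower u) (lower y) + s2_int (upper u) (upper y)) V2 \<and>
      (\<forall>w1. w1 \<noteq> 0 \<longrightarrow> s1_int 0 w1 \<le> 0) \<and> (\<forall>w2. w2 \<noteq> 0 \<longrightarrow> s2_int 0 w2 \<le> 0)"
    using int by (intro exI[of _ s1_int] exI[of _ s2_int]) auto
next
  assume "asymptotically_stable (coupled_matrix A1 B1 C1 A2 B2 C2) \<and>
      additive_quadratic_lyapunov (coupled_matrix A1 B1 C1 A2 B2 C2) V1 V2"
  then obtain P1 P2 where pd: "pos_def_matrix P1" "pos_def_matrix P2"
    and V: "\<And>x1. V1 x1 = x1 \<bullet> (P1 *v x1)" "\<And>x2. V2 x2 = x2 \<bullet> (P2 *v x2)"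
    and nd: "neg_def_matrix (transpose (coupled_matrix A1 B1 C1 A2 B2 C2) ** block_matrix P1 0 0 P2
      + block_matrix P1 0 0 P2 ** coupled_matrix A1 B1 C1 A2 B2 C2)"
    unfolding additive_quadratic_lyapunov_def Let_def by blast
  have sym: "symmetric_matrix P1" "symmetric_matrix P2"
    using pd by (simp_all add: pos_def_matrix_def)
  \<comment> \<open>Without external channels \<open>g1\<close> and \<open>g2\<close> are just the
    storage derivatives, and the state alone plays the part of \<open>y\<close>.\<close>
  define g1 :: "(real ^ 'n1) \<times> (real ^ 'p2) \<Rightarrow> real"
    where "g1 = (\<lambda>(x, v). 2 * (x \<bullet> (P1 *v (A1 *v x + B1 *v v))))"
  define g2 :: "(real ^ 'n2) \<times> (real ^ 'p1) \<Rightarrow> real"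
    where "g2 = (\<lambda>(x, v). 2 * (x \<bullet> (P2 *v (A2 *v x + B2 *v v))))"
  note form_rules = quadratic_form_cmult quadratic_form_inner bounded_linear_add
    bounded_linear_matrix_vector_mult bounded_linear_fst bounded_linear_snd
  have g1: "quadratic_form g1"
    unfolding g1_def case_prod_unfold by (intro form_rules)
  have g2: "quadratic_form g2"
    unfolding g2_def case_prod_unfold by (intro form_rules)
  have zero: "g1 (0, v) = 0" "g2 (0, w) = 0" for v w
    by (simp_all add: g1_def g2_def)
  have neg: "g1 (x1, C2 *v x2) + g2 (x2, C1 *v x1) < 0" if "(x1, x2) \<noteq> 0" for x1 x2
  proof -
    have "col x1 x2 \<noteq> 0"
      using that by (simp add: col_eq_0_iff zero_prod_def)
    \<comment> \<open>The Lyapunov inequality read as a derivative; block diagonality of the matrix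
      then separates it into \<open>g1\<close> and \<open>g2\<close>.\<close>
    then have "2 * (col x1 x2 \<bullet> (block_matrix P1 0 0 P2 *v
        (coupled_matrix A1 B1 C1 A2 B2 C2 *v col x1 x2))) < 0"
      using nd unfolding neg_def_matrix_def lyapunov_inner[OF symmetric_block_diag[OF sym]]
      by blast
    then show ?thesis
      by (simp add: coupled_matrix_mult block_matrix_mult inner_col g1_def g2_def)
  qed
  obtain s1_int s2_int where int: "quadratic_supply s1_int" "quadratic_supply s2_int"
    "\<And>v w. s1_int v w + s2_int w v = 0"
    "\<And>x v. (x, v) \<noteq> 0 \<Longrightarrow> g1 (x, v) < s1_int v (C1 *v x)"
    "\<And>x w. (x, w) \<noteq> 0 \<Longrightarrow> g2 (x, w) < s2_int w (C2 *v x)"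
    "\<And>w. w \<noteq> 0 \<Longrightarrow> s1_int 0 w \<le> 0" "\<And>v. v \<noteq> 0 \<Longrightarrow> s2_int 0 v \<le> 0"
    using internal_supplies[OF g1 zero(1) g2 zero(2) matrix_vector_mul_bounded_linear
        matrix_vector_mul_bounded_linear neg] by blast
  have "strictly_dissipative A1 B1 C1 0 s1_int V1"
    unfolding strictly_dissipative_def
    by (intro exI[of _ P1]) (use sym V int(4) in \<open>auto simp: g1_def zero_prod_def\<close>)
  moreover have "strictly_dissipative A2 B2 C2 0 s2_int V2"
    unfolding strictly_dissipative_def
    by (intro exI[of _ P2]) (use sym V int(5) in \<open>auto simp: g2_def zero_prod_def\<close>)
  ultimately show "\<exists>(s1_int :: real ^ 'p2 \<Rightarrow> real ^ 'p1 \<Rightarrow> real) (s2_int :: real ^ 'p1 \<Rightarrow> real ^ 'p2 \<Rightarrow> real).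
      quadratic_supply s1_int \<and> quadratic_supply s2_int \<and>
      (\<forall>v1 w1 v2 w2. v1 = w2 \<and> v2 = w1 \<longrightarrow> s1_int v1 w1 + s2_int v2 w2 = 0) \<and>
      strictly_dissipative A1 B1 C1 0 s1_int V1 \<and>
      strictly_dissipative A2 B2 C2 0 s2_int V2 \<and>
      (\<forall>w1. w1 \<noteq> 0 \<longrightarrow> s1_int 0 w1 \<le> 0) \<and> (\<forall>w2. w2 \<noteq> 0 \<longrightarrow> s2_int 0 w2 \<le> 0)"
    using int by (intro exI[of _ s1_int] exI[of _ s2_int]) auto
qed

end
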